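(* Let $G$ be a finite group acting by conjugation on the set $\mathcal{Q}_G$ of its sections, and let $\mathbf{A}(\leq)$, $\mathbf{A}(\leq_K)$, $\mathbf{A}(\leq_{P/K})$, $\mathbf{A}(\leq_P)$ be the class incidence matrices of the $G$-posets $(\mathcal{Q}_G,\leq)$, $(\mathcal{Q}_G,\leq_K)$, $(\mathcal{Q}_G,\leq_{P/K})$, $(\mathcal{Q}_G,\leq_P)$, respectively. Then $$\mathbf{A}(\leq) = \mathbf{A}(\leq_K)\cdot \mathbf{A}(\leq_{P/K})\cdot \mathbf{A}(\leq_P).$$
   Context: A section of a finite group $G$ is a pair $(P,K)$ of subgroups of $G$ with $K \trianglelefteq P$; $\mathcal{Q}_G$ is the set of all sections of $G$. $G$ acts on $\mathcal{Q}_G$ by $(P,K)^g=(P^g,K^g)$. Partial orders on $\mathcal{Q}_G$: $(P',K') \leq (P,K)$ if $P'\leq P$ and $K'\leq K$. Given $(P',K')\leq (P,K)$, write $(P',K')\leq_P (P,K)$ if $P'=P$; write $(P',K')\leq_K (P,K)$ if $K'=K$; write $(P',K')\leq_{P/K}(P,K)$ if the map $P'/K'\to P/K$, $pK'\mapsto pK$ ($p\in P'$), is an isomorphism. (The subscripts $P$, $K$, $P/K$ are just names of the relations.) Class incidence matrix: if a finite group $G$ acts on a finite poset $(X,\preceq)$ so that $x\preceq y$ implies $x.a\preceq y.a$ (a $G$-poset), and $T\subseteq X$ is a transversal of the $G$-orbits, then the class incidence matrix is $\mathbf{A}(\preceq)=(\mathbf{a}_{xy})_{x,y\in T}$ with $\mathbf{a}_{xy}=\#\{x'\in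 X : x' \text{ in the } G\text{-orbit of } x,\ y\preceq x'\}$; this does not depend on the choice of orbit representatives. All four matrices are taken with respect to the same transversal of the $G$-orbits on $\mathcal{Q}_G$. *)

theory Defs
  imports "HOL-Algebra.Coset" "HOL-Algebra.Group_Action" "Jordan_Normal_Form.Matrix"
begin

definition sections :: "('a, 'b) monoid_scheme \<Rightarrow> ('a set \<times> 'a set) set" where
  "sections G =
     {(P, K). subgroup P G \<and> subgroup K G \<and> K \<lhd> (G\<lparr>carrier := P\<rparr>)}"

(* H^g = g^{-1} H g *)
definition conj_subset :: "('a, 'b) monoid_scheme \<Rightarrow> 'a \<Rightarrow> 'a set \<Rightarrow> 'a set" where
  "conj_subset G g H = (inv\<^bsub>G\<^esub> g <#\<^bsub>G\<^esub> H) #>\<^bsub>G\<^esub> g"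

definition conj_section ::
    "('a, 'b) monoid_scheme \<Rightarrow> 'a \<Rightarrow> 'a set \<times> 'a set \<Rightarrow> 'a set \<times> 'a set" where
  "conj_section G g = (\<lambda>(P, K). (conj_subset G g P, conj_subset G g K))"

fun sec_le :: "'a set \<times> 'a set \<Rightarrow> 'a set \<times> 'a set \<Rightarrow> bool" where
  "sec_le (P', K') (P, K) \<longleftrightarrow> P' \<subseteq> P \<and> K' \<subseteq> K"

fun sec_le_P :: "'a set \<times> 'a set \<Rightarrow> 'a set \<times> 'a set \<Rightarrow> bool" where
  "sec_le_P (P', K') (P, K) \<longleftrightarrow> sec_le (P', K') (P, K) \<and> P' = P"

fun sec_le_K :: "'a set \<times> 'a set \<Rightarrow> 'a set \<times> 'a set \<Rightarrow> bool" where
  "sec_le_K (P', K') (P, K) \<longleftrightarrow> sec_le (P', K') (P, K) \<and> K' = K"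

(* Since K' is contained in K, the assignment pK' \<mapsto> pK is well defined on the cosets,
   so f is uniquely determined on P'/K'. *)
fun sec_le_PK ::
    "('a, 'b) monoid_scheme \<Rightarrow> 'a set \<times> 'a set \<Rightarrow> 'a set \<times> 'a set \<Rightarrow> bool" where
  "sec_le_PK G (P', K') (P, K) \<longleftrightarrow>
     sec_le (P', K') (P, K) \<and>
     (\<exists>f \<in> iso (G\<lparr>carrier := P'\<rparr> Mod K') (G\<lparr>carrier := P\<rparr> Mod K).
        \<forall>p\<in>P'. f (p <#\<^bsub>G\<^esub> K') = p <#\<^bsub>G\<^esub> K)"

(* act g x stands for x.g, a right action of G on X; the library constants orbit and orbits
   only form the sets {x.g | g \<in> G} and do not depend on the side of the action. *)
definition orbit_transversal ::
    "('a, 'b) monoid_scheme \<Rightarrow> ('a \<Rightarrow> 'x \<Rightarrow> 'x) \<Rightarrow> 'x set \<Rightarrow> 'x set \<Rightarrow> bool" where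
  "orbit_transversal G act X T \<longleftrightarrow>
     T \<subseteq> X \<and> (\<forall>B \<in> orbits G X act. \<exists>!t. t \<in> T \<and> t \<in> B)"

(* The list ts enumerates the transversal without repetition and so orders the rows and
   columns: position (i, j) holds the entry for x = ts ! i and y = ts ! j. *)
definition class_incidence_matrix ::
    "('a, 'b) monoid_scheme \<Rightarrow> ('a \<Rightarrow> 'x \<Rightarrow> 'x) \<Rightarrow> 'x set \<Rightarrow> ('x \<Rightarrow> 'x \<Rightarrow> bool)
      \<Rightarrow> 'x list \<Rightarrow> int mat" where
  "class_incidence_matrix G act X r ts =
     mat (length ts) (length ts)
       (\<lambda>(i, j). int (card {x' \<in> X. x' \<in> orbit G act (ts ! i) \<and> r (ts ! j) x'}))"

end

theory Submission
  imports Defs "HOL-Algebra.Left_Coset" "HOL-Algebra.Zassenhaus"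
begin

text \<open>An entry of a product of class incidence matrices counts chains \<open>z \<preceq> y \<preceq> x'\<close> with \<open>x'\<close> in the
  orbit of \<open>x\<close>. Hence it suffices that \<open>(P', K') \<le> (P, K)\<close> factors uniquely through
  \<open>(P', K') \<le>\<^sub>P (P', P' \<inter> K) \<le>\<^bsub>P/K\<^esub> (P' K, K) \<le>\<^sub>K (P, K)\<close>: by the second isomorphism theorem, the canonical
  map \<open>A/B \<rightarrow> C/D\<close> is bijective exactly if \<open>B = A \<inter> D\<close> and \<open>C = A D\<close>.\<close>

section \<open>Right actions and products of class incidence matrices\<close>

locale right_action = group G for G (structure) +
  fixes act :: "'a \<Rightarrow> 'x \<Rightarrow> 'x" and X :: "'x set"
  assumes act_closed: "g \<in> carrier G \<Longrightarrow> x \<in> X \<Longrightarrow> act g x \<in> X"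
    and act_one: "x \<in> X \<Longrightarrow> act \<one> x = x"
    and act_mult: "g \<in> carrier G \<Longrightarrow> h \<in> carrier G \<Longrightarrow> x \<in> X \<Longrightarrow> act (g \<otimes> h) x = act h (act g x)"
begin

lemma orbit_closed:
  assumes "x \<in> X" "y \<in> orbit G act x" "g \<in> carrier G"
  shows "act g y \<in> orbit G act x"
proof -
  obtain h where h: "h \<in> carrier G" "y = act h x" using assms(2) unfolding orbit_def by auto
  then have "act g y = act (h \<otimes> g) x" using act_mult assms by simp
  then show ?thesis unfolding orbit_def using h(1) assms(3) by blast
qed

lemma act_inv_cancel:
  assumes "x \<in> X" "g \<in> carrier G"
  shows "act (inv g) (act g x) = x" "act g (act (inv g) x) = x"
  using act_mult[of g "inv g" x] act_mult[of "inv g" g x] act_one assms by auto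

lemma orbit_sym:
  assumes "x \<in> X" "y \<in> orbit G act x"
  shows "x \<in> orbit G act y"
proof -
  obtain g where g: "g \<in> carrier G" "y = act g x" using assms(2) unfolding orbit_def by auto
  then have "x = act (inv g) y" using act_inv_cancel assms(1) by simp
  then show ?thesis unfolding orbit_def using g(1) by blast
qed

text \<open>\<open>orbit_transversal\<close> asks for one representative in each orbit; by symmetry
  of orbits, each element then lies in the orbit of just one representative. So the orbits of the
  representatives partition \<open>X\<close>, and sums over them merge into one sum over
  \<open>X\<close>.\<close>

lemma transversal_ex1:
  assumes "orbit_transversal G act X T" "y \<in> X"
  shows "\<exists>!t. t \<in> T \<and> y \<in> orbit G act t"
proof -
  have T: "T \<subseteq> X" and ex: "\<exists>!t. t \<in> T \<and> t \<in> orbit G act y"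
    using assms unfolding orbit_transversal_def orbits_def by auto
  have "t \<in> T \<and> t \<in> orbit G act y \<longleftrightarrow> t \<in> T \<and> y \<in> orbit G act t" for t
    using T orbit_sym assms(2) by blast
  with ex show ?thesis by simp
qed

text \<open>Acting by \<open>g\<close> carries the elements counted above \<open>y\<close> to those
  counted above \<open>act g y\<close>, and \<open>inv g\<close> carries them back. This lets a
  matrix entry at a representative speak for every element of its orbit.\<close>

lemma class_incidence_invariant:
  assumes x: "x \<in> X" and y: "y \<in> X" and y': "y' \<in> orbit G act y"
    and equivariant: "\<And>g u v. \<lbrakk>g \<in> carrier G; u \<in> X; v \<in> X; r u v\<rbrakk> \<Longrightarrow> r (act g u) (act g v)"
  shows "card {x' \<in> X. x' \<in> orbit G act x \<and> r y' x'}
    = card {x' \<in> X. x' \<in> orbit G act x \<and> r y x'}"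
proof -
  let ?N = "\<lambda>y. {x' \<in> X. x' \<in> orbit G act x \<and> r y x'}"
  obtain g where g: "g \<in> carrier G" "y' = act g y" using y' unfolding orbit_def by auto
  \<comment> \<open>Used for \<open>g\<close> and for \<open>inv g\<close>, this yields both
    directions of the bijection.\<close>
  have shift: "act h v \<in> ?N (act h u)" if "h \<in> carrier G" "u \<in> X" "v \<in> ?N u" for h u v
    using that act_closed[OF that(1)] orbit_closed[OF x _ that(1)] equivariant[OF that(1,2)] by blast
  have y'X: "y' \<in> X" using act_closed[OF g(1) y] g(2) by simp
  have "act (inv g) y' = y" using act_inv_cancel(1)[OF y g(1)] g(2) by simp
  have maps: "act g v \<in> ?N y'" if "v \<in> ?N y" for v
    using shift[OF g(1) y that] g(2) by simp
  have maps_inv: "act (inv g) v \<in> ?N y" if "v \<in> ?N y'" for v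
    using shift[OF inv_closed[OF g(1)] y'X that] \<open>act (inv g) y' = y\<close> by simp
  have "bij_betw (act g) (?N y) (?N y')"
  proof (rule bij_betw_byWitness[where f' = "act (inv g)"])
    show "\<forall>v \<in> ?N y. act (inv g) (act g v) = v" "\<forall>v \<in> ?N y'. act g (act (inv g) v) = v"
      using act_inv_cancel[OF _ g(1)] by blast+
    show "act g ` ?N y \<subseteq> ?N y'" "act (inv g) ` ?N y' \<subseteq> ?N y"
      using maps maps_inv by blast+
  qed
  from bij_betw_same_card[OF this] show ?thesis by (rule sym)
qed

text \<open>Entry (x, z) of the product sums, over representatives \<open>t\<close>, the number of
  \<open>x'\<close> above \<open>t\<close> times the number of \<open>y\<close> above
  \<open>z\<close> in the orbit of \<open>t\<close>. By invariance \<open>t\<close> may be replaced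
  by each such \<open>y\<close>, so the sum counts pairs \<open>(y, x')\<close> with
  \<open>s z y\<close> and \<open>r y x'\<close>. The column index is the lower end of a chain, so
  the lower relation \<open>s\<close> gives the right-hand factor.\<close>

proposition class_incidence_matrix_mult:
  assumes fin: "finite X" and dist: "distinct ts" and tr: "orbit_transversal G act X (set ts)"
    and equivariant: "\<And>g u v. \<lbrakk>g \<in> carrier G; u \<in> X; v \<in> X; r u v\<rbrakk> \<Longrightarrow> r (act g u) (act g v)"
    and factor: "\<And>z x. \<lbrakk>z \<in> X; x \<in> X\<rbrakk> \<Longrightarrow> q z x \<longleftrightarrow> (\<exists>y \<in> X. s z y \<and> r y x)"
    and unique: "\<And>z x y y'. \<lbrakk>z \<in> X; x \<in> X; y \<in> X; y' \<in> X; s z y; r y x; s z y'; r y' x\<rbrakk> \<Longrightarrow> y = y'"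
  shows "class_incidence_matrix G act X q ts
    = class_incidence_matrix G act X r ts * class_incidence_matrix G act X s ts"
proof (rule eq_matI)
  fix i j
  assume "i < dim_row (class_incidence_matrix G act X r ts * class_incidence_matrix G act X s ts)"
    and "j < dim_col (class_incidence_matrix G act X r ts * class_incidence_matrix G act X s ts)"
  then have i: "i < length ts" and j: "j < length ts"
    by (simp_all add: class_incidence_matrix_def)
  define x z where "x = ts ! i" and "z = ts ! j"
  define N where "N y = card {x' \<in> X. x' \<in> orbit G act x \<and> r y x'}" for y
  define Y where "Y t = {y \<in> X. y \<in> orbit G act t \<and> s z y}" for t
  have TX: "set ts \<subseteq> X" using tr unfolding orbit_transversal_def by auto
  have x: "x \<in> X" and z: "z \<in> X" using TX i j x_def z_def by auto
  have finY: "finite (Y t)" for t unfolding Y_def using fin by simp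
  have Y_disj: "Y t \<inter> Y t' = {}" if "t \<in> set ts" "t' \<in> set ts" "t \<noteq> t'" for t t'
    using transversal_ex1[OF tr] that unfolding Y_def by blast
  have Y_Un: "(\<Union>t \<in> set ts. Y t) = {y \<in> X. s z y}"
    using transversal_ex1[OF tr] unfolding Y_def by blast
  have N_Y: "N t * card (Y t) = (\<Sum>y \<in> Y t. N y)" if "t \<in> set ts" for t
  proof -
    have "N y = N t" if "y \<in> Y t" for y
      unfolding N_def using \<open>t \<in> set ts\<close> TX that x equivariant
      by (intro class_incidence_invariant) (auto simp: Y_def)
    then show ?thesis by (simp add: mult.commute)
  qed
  \<comment> \<open>Chains are projected to their top \<open>x'\<close>: \<open>factor\<close> says
    which tops occur, \<open>unique\<close> that none occurs twice.\<close>
  have snd_img: "snd ` (SIGMA y:{y \<in> X. s z y}. {x' \<in> X. x' \<in> orbit G act x \<and> r y x'})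
      = {x' \<in> X. x' \<in> orbit G act x \<and> q z x'}"
    using factor[OF z] by (force simp: image_def)
  have snd_inj: "inj_on snd (SIGMA y:{y \<in> X. s z y}. {x' \<in> X. x' \<in> orbit G act x \<and> r y x'})"
    using unique[OF z] by (auto simp: inj_on_def)
  \<comment> \<open>As \<open>ts\<close> is distinct, summing over positions is summing over
    representatives.\<close>
  have "(\<Sum>k<length ts. N (ts ! k) * card (Y (ts ! k))) = (\<Sum>t \<in> set ts. N t * card (Y t))"
    using sum.reindex_bij_betw[OF bij_betw_nth[OF dist refl refl]] by fast
  also have "\<dots> = (\<Sum>t \<in> set ts. \<Sum>y \<in> Y t. N y)"
    using N_Y by simp
  also have "\<dots> = (\<Sum>y | y \<in> X \<and> s z y. N y)"
    using sum.UNION_disjoint[of "set ts" Y N] finY Y_disj Y_Un by simp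
  also have "\<dots> = card (SIGMA y:{y \<in> X. s z y}. {x' \<in> X. x' \<in> orbit G act x \<and> r y x'})"
    unfolding N_def using fin by (subst card_SigmaI) auto
  also have "\<dots> = card {x' \<in> X. x' \<in> orbit G act x \<and> q z x'}"
    using card_image[OF snd_inj] snd_img by simp
  finally have "int (card {x' \<in> X. x' \<in> orbit G act x \<and> q z x'})
      = (\<Sum>k<length ts. int (N (ts ! k)) * int (card (Y (ts ! k))))"
    by (simp flip: of_nat_mult of_nat_sum)
  then show "class_incidence_matrix G act X q ts $$ (i, j)
      = (class_incidence_matrix G act X r ts * class_incidence_matrix G act X s ts) $$ (i, j)"
    using i j by (simp add: class_incidence_matrix_def scalar_prod_def N_def Y_def x_def z_def
        lessThan_atLeast0)
qed (simp_all add: class_incidence_matrix_def)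

end

section \<open>Sections, their conjugation action and their cosets\<close>

context group
begin

text \<open>Normality inside \<open>G\<lparr>carrier := P\<rparr>\<close> is rephrased by products
  and inverses of \<open>G\<close>, so that later closure arguments never leave
  \<open>G\<close>.\<close>

lemma sections_iff:
  "(P, K) \<in> sections G \<longleftrightarrow> subgroup P G \<and> subgroup K G \<and> K \<subseteq> P
    \<and> (\<forall>p \<in> P. \<forall>k \<in> K. p \<otimes> k \<otimes> inv p \<in> K)"
proof (cases "subgroup P G")
  case True
  interpret H: group "G\<lparr>carrier := P\<rparr>" using subgroup_imp_group[OF True] .
  have "subgroup K (G\<lparr>carrier := P\<rparr>) \<longleftrightarrow> K \<subseteq> P" if "subgroup K G"
    using subgroup_incl[OF that True] subgroup.subset[of K "G\<lparr>carrier := P\<rparr>"] by auto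
  moreover have "K \<lhd> G\<lparr>carrier := P\<rparr> \<longleftrightarrow> subgroup K (G\<lparr>carrier := P\<rparr>)
      \<and> (\<forall>p \<in> P. \<forall>k \<in> K. p \<otimes> k \<otimes> inv p \<in> K)"
    using H.normal_inv_iff[of K] True by simp
  ultimately show ?thesis
    using True unfolding sections_def by blast
qed (simp add: sections_def)

lemma conj_subset_eq_image:
  assumes "H \<subseteq> carrier G" "g \<in> carrier G"
  shows "conj_subset G g H = (\<lambda>h. inv g \<otimes> h \<otimes> g) ` H"
  unfolding conj_subset_def l_coset_def r_coset_def by auto

text \<open>Conjugating a subset is taking its image under this inner automorphism, so facts on
  images under homomorphisms apply to sections.\<close>

lemma group_hom_conj:
  assumes "g \<in> carrier G"
  shows "group_hom G G (\<lambda>h. inv g \<otimes> h \<otimes> g)"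
proof -
  \<comment> \<open>This cancels the inner \<open>g \<otimes> inv g\<close> in a product of two
    conjugates once it is bracketed to the right.\<close>
  have "g \<otimes> (inv g \<otimes> z) = z" if "z \<in> carrier G" for z
    using that assms by (simp flip: m_assoc)
  then show ?thesis using assms by unfold_locales (auto simp: hom_def m_assoc)
qed

lemma inj_on_conj: "g \<in> carrier G \<Longrightarrow> inj_on (\<lambda>h. inv g \<otimes> h \<otimes> g) (carrier G)"
  by (auto simp: inj_on_def)

lemma conj_section_eq:
  assumes "(P, K) \<in> sections G" "g \<in> carrier G"
  shows "conj_section G g (P, K) = ((\<lambda>h. inv g \<otimes> h \<otimes> g) ` P, (\<lambda>h. inv g \<otimes> h \<otimes> g) ` K)"
  using assms by (simp add: conj_section_def sections_iff conj_subset_eq_image subgroup.subset)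

lemma conj_section_closed:
  assumes "x \<in> sections G" "g \<in> carrier G"
  shows "conj_section G g x \<in> sections G"
proof -
  obtain P K where x: "x = (P, K)" by (cases x)
  interpret c: group_hom G G "\<lambda>h. inv g \<otimes> h \<otimes> g" using group_hom_conj[OF assms(2)] .
  have PK: "subgroup P G" "subgroup K G" "K \<subseteq> P" "\<And>p k. p \<in> P \<Longrightarrow> k \<in> K \<Longrightarrow> p \<otimes> k \<otimes> inv p \<in> K"
    using assms(1) x by (auto simp: sections_iff)
  let ?c = "\<lambda>h. inv g \<otimes> h \<otimes> g"
  have "?c p \<otimes> ?c k \<otimes> inv (?c p) \<in> ?c ` K" if pk: "p \<in> P" "k \<in> K" for p k
  proof -
    have carr: "p \<in> carrier G" "k \<in> carrier G"
      using pk PK subgroup.mem_carrier by metis+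
    have "?c (p \<otimes> k \<otimes> inv p) = ?c (p \<otimes> k) \<otimes> ?c (inv p)"
      by (rule c.hom_mult) (use carr in simp_all)
    also have "\<dots> = ?c p \<otimes> ?c k \<otimes> inv (?c p)"
      by (simp only: c.hom_mult[OF carr] c.hom_inv[OF carr(1)])
    finally show ?thesis using PK(4)[OF pk] by (metis imageI)
  qed
  moreover have "subgroup (?c ` P) G" "subgroup (?c ` K) G"
    using c.subgroup_img_is_subgroup PK by blast+
  ultimately show ?thesis
    using PK(3) unfolding x conj_section_eq[OF assms[unfolded x]] sections_iff by blast
qed

text \<open>Since \<open>inv (g \<otimes> h) = inv h \<otimes> inv g\<close>, conjugating by
  \<open>g \<otimes> h\<close> means conjugating first by \<open>g\<close> and then by
  \<open>h\<close>.\<close>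

lemma conj_section_right_action: "right_action G (conj_section G) (sections G)"
proof
  fix g x assume "g \<in> carrier G" "x \<in> sections G"
  then show "conj_section G g x \<in> sections G" by (simp add: conj_section_closed)
next
  fix x assume x: "x \<in> sections G"
  obtain P K where PK: "x = (P, K)" by (cases x)
  have "P \<subseteq> carrier G" "K \<subseteq> carrier G"
    using x PK subgroup.subset by (auto simp: sections_iff)
  then show "conj_section G \<one> x = x"
    using conj_section_eq[of P K \<one>] x PK by (auto simp: subset_iff image_iff)
next
  fix g h x assume gh: "g \<in> carrier G" "h \<in> carrier G" and x: "x \<in> sections G"
  obtain P K where PK: "x = (P, K)" by (cases x)
  have sub: "P \<subseteq> carrier G" "K \<subseteq> carrier G"
    using x PK subgroup.subset by (auto simp: sections_iff)
  have "inv (g \<otimes> h) \<otimes> a \<otimes> (g \<otimes> h) = inv h \<otimes> (inv g \<otimes> a \<otimes> g) \<otimes> h" if "a \<in> carrier G" for a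
    using that gh by (simp add: m_assoc inv_mult_group)
  then have "(\<lambda>a. inv (g \<otimes> h) \<otimes> a \<otimes> (g \<otimes> h)) ` H
      = (\<lambda>a. inv h \<otimes> a \<otimes> h) ` (\<lambda>a. inv g \<otimes> a \<otimes> g) ` H" if "H \<subseteq> carrier G" for H
    unfolding image_image using that by (intro image_cong) auto
  then show "conj_section G (g \<otimes> h) x = conj_section G h (conj_section G g x)"
    using conj_section_closed[OF x gh(1)] x gh sub unfolding PK by (simp add: conj_section_eq)
qed

text \<open>The elements of a \<open>Mod\<close> quotient are right cosets in
  \<open>G\<lparr>carrier := P\<rparr>\<close>, while \<open>sec_le_PK\<close> uses left cosets in
  \<open>G\<close>; normality identifies the two.\<close>

lemma l_coset_eq_r_coset:
  assumes "(P, K) \<in> sections G" "p \<in> P"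
  shows "p <# K = K #>\<^bsub>G\<lparr>carrier := P\<rparr>\<^esub> p"
proof -
  have "K \<lhd> G\<lparr>carrier := P\<rparr>" using assms(1) by (simp add: sections_def)
  from normal.coset_eq[OF this] show ?thesis
    using assms(2) by (simp add: l_coset_def r_coset_def)
qed

section \<open>Canonical maps of quotients, and meets and joins of sections\<close>

lemma subset_set_mult:
  assumes "subgroup A G" "subgroup D G"
  shows "A \<subseteq> A <#> D" "D \<subseteq> A <#> D"
proof -
  have "a = a \<otimes> \<one>" if "a \<in> A" for a using that assms subgroup.mem_carrier by force
  then show "A \<subseteq> A <#> D" using subgroup.one_closed[OF assms(2)] by (fastforce simp: set_mult_def)
  have "d = \<one> \<otimes> d" if "d \<in> D" for d using that assms subgroup.mem_carrier by force
  then show "D \<subseteq> A <#> D" using subgroup.one_closed[OF assms(1)] by (fastforce simp: set_mult_def)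
qed

text \<open>Injectivity of the canonical map gives the condition on \<open>B\<close>, surjectivity
  the one on \<open>C\<close>. Conversely, \<open>p \<mapsto> p <# D\<close> on \<open>A\<close> has
  kernel \<open>A \<inter> D\<close> and reaches every coset of \<open>D\<close> in
  \<open>A <#> D\<close>, so the first isomorphism theorem applies.\<close>

lemma sec_le_PK_iff:
  assumes A: "(A, B) \<in> sections G" and C: "(C, D) \<in> sections G"
  shows "sec_le_PK G (A, B) (C, D) \<longleftrightarrow> B = A \<inter> D \<and> C = A <#> D"
proof
  have sA: "subgroup A G" and sB: "subgroup B G" and sC: "subgroup C G" and sD: "subgroup D G"
    and BA: "B \<subseteq> A" and DC: "D \<subseteq> C"
    using A C by (auto simp: sections_iff)
  have mem_AB: "p <# B = B \<longleftrightarrow> p \<in> B" if "p \<in> A" for p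
    using that sA sB by (metis coset_join3 lcos_self subgroup.mem_carrier)
  have mem_CD: "p <# D = D \<longleftrightarrow> p \<in> D" if "p \<in> C" for p
    using that sC sD by (metis coset_join3 lcos_self subgroup.mem_carrier)
  {
    assume "sec_le_PK G (A, B) (C, D)"
    then obtain f where sub: "A \<subseteq> C" "B \<subseteq> D"
      and f: "f \<in> iso (G\<lparr>carrier := A\<rparr> Mod B) (G\<lparr>carrier := C\<rparr> Mod D)"
      and fp: "\<And>p. p \<in> A \<Longrightarrow> f (p <# B) = p <# D" by auto
    have cA: "carrier (G\<lparr>carrier := A\<rparr> Mod B) = (\<lambda>p. p <# B) ` A"
      using l_coset_eq_r_coset[OF A] by (auto simp: FactGroup_def RCOSETS_def)
    have cC: "carrier (G\<lparr>carrier := C\<rparr> Mod D) = (\<lambda>p. p <# D) ` C"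
      using l_coset_eq_r_coset[OF C] by (auto simp: FactGroup_def RCOSETS_def)
    have bij: "bij_betw f ((\<lambda>p. p <# B) ` A) ((\<lambda>p. p <# D) ` C)"
      using f cA cC by (simp add: iso_def)
    have "p \<in> B" if p: "p \<in> A" "p \<in> D" for p
    proof -
      \<comment> \<open>Both sides equal the trivial coset \<open>D\<close>, because
        \<open>p\<close> lies in \<open>D\<close>.\<close>
      have "f (p <# B) = f (\<one> <# B)"
        using p fp[of p] fp[of \<one>] mem_CD[of p] mem_CD[of \<one>] sub
          subgroup.one_closed[OF sA] subgroup.one_closed[OF sD] by auto
      then have "p <# B = \<one> <# B"
        using bij p sA subgroup.one_closed[OF sA] by (auto simp: bij_betw_def dest: inj_onD)
      then show ?thesis
        using mem_AB[of p] mem_AB[of \<one>] p sA sB by (simp add: subgroup.one_closed)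
    qed
    then have 1: "B = A \<inter> D" using BA sub by auto
    have "c \<in> A <#> D" if c: "c \<in> C" for c
    proof -
      \<comment> \<open>By surjectivity the coset of \<open>c\<close> has a representative in
        \<open>A\<close>.\<close>
      have "c <# D \<in> f ` (\<lambda>p. p <# B) ` A"
        using bij c unfolding bij_betw_def by blast
      then obtain p where p: "p \<in> A" "c <# D = p <# D" using fp by blast
      then have "c \<in> p <# D"
        using lcos_self[OF _ sD] c sC subgroup.mem_carrier by metis
      then show ?thesis using p by (auto simp: l_coset_def set_mult_def)
    qed
    moreover have "a \<otimes> d \<in> C" if "a \<in> A" "d \<in> D" for a d
      using that sub DC subgroup.m_closed[OF sC] by blast
    ultimately have "C = A <#> D" by (auto simp: set_mult_def)
    with 1 show "B = A \<inter> D \<and> C = A <#> D" by simp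
  }
  assume BC: "B = A \<inter> D \<and> C = A <#> D"
  have AC: "A \<subseteq> C" using BC subset_set_mult(1)[OF sA sD] by simp
  interpret A: group "G\<lparr>carrier := A\<rparr>" using subgroup_imp_group[OF sA] .
  interpret N: normal D "G\<lparr>carrier := C\<rparr>" using C by (simp add: sections_def)
  have "(\<lambda>p. p <# D) \<in> hom (G\<lparr>carrier := A\<rparr>) (G\<lparr>carrier := C\<rparr> Mod D)"
    using N.r_coset_hom_Mod AC l_coset_eq_r_coset[OF C] subgroup.m_closed[OF sA]
    by (auto simp: hom_def subset_iff Pi_iff)
  then interpret h: group_hom "G\<lparr>carrier := A\<rparr>" "G\<lparr>carrier := C\<rparr> Mod D" "\<lambda>p. p <# D"
    by (intro group_hom.intro group_hom_axioms.intro A.group_axioms N.factorgroup_is_group)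
  have ker: "kernel (G\<lparr>carrier := A\<rparr>) (G\<lparr>carrier := C\<rparr> Mod D) (\<lambda>p. p <# D) = B"
    using BC AC mem_CD by (auto simp: kernel_def FactGroup_def)
  \<comment> \<open>Used twice: for surjectivity, where \<open>C = A <#> D\<close>, and for
    constancy on cosets of \<open>B\<close>, where \<open>B \<subseteq> D\<close>.\<close>
  have absorb: "(a \<otimes> d) <# D = a <# D" if "a \<in> A" "d \<in> D" for a d
    using that sA sD coset_join3[of d D] lcos_m_assoc[of D a d] subgroup.mem_carrier subgroup.subset
    by metis
  have "c <# D \<in> (\<lambda>p. p <# D) ` A" if "c \<in> C" for c
  proof -
    have "c \<in> A <#> D" using that BC by blast
    then obtain a d where "a \<in> A" "d \<in> D" "c = a \<otimes> d" by (auto simp: set_mult_def)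
    then show ?thesis using absorb by blast
  qed
  then have "(\<lambda>p. p <# D) ` A = (\<lambda>p. p <# D) ` C" using AC by blast
  also have "\<dots> = carrier (G\<lparr>carrier := C\<rparr> Mod D)"
    using l_coset_eq_r_coset[OF C] by (auto simp: FactGroup_def RCOSETS_def)
  finally have "(\<lambda>U. the_elem ((\<lambda>p. p <# D) ` U))
      \<in> iso (G\<lparr>carrier := A\<rparr> Mod B) (G\<lparr>carrier := C\<rparr> Mod D)"
    using h.FactGroup_iso_set ker by simp
  \<comment> \<open>The induced isomorphism picks the element of the image of a coset; it is the
    required map because that image is the singleton of \<open>p <# D\<close>.\<close>
  moreover have "the_elem ((\<lambda>p. p <# D) ` (p <# B)) = p <# D" if p: "p \<in> A" for p
  proof -
    have "u <# D = p <# D" if u: "u \<in> p <# B" for u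
    proof -
      obtain b where "b \<in> B" "u = p \<otimes> b" using u by (auto simp: l_coset_def)
      with absorb[OF p, of b] BC show ?thesis by blast
    qed
    moreover have "p \<in> p <# B"
      using lcos_self[OF _ sB] p sA subgroup.mem_carrier by metis
    ultimately have "(\<lambda>p. p <# D) ` (p <# B) = {p <# D}" by blast
    then show ?thesis by simp
  qed
  moreover have "sec_le (A, B) (C, D)" using AC BC by simp
  ultimately show "sec_le_PK G (A, B) (C, D)"
    unfolding sec_le_PK.simps by (intro conjI bexI ballI)
qed

text \<open>By \<open>sec_le_PK_iff\<close> no isomorphism has to be transported: conjugation
  preserves the intersection because it is injective, and the product because it is a
  homomorphism.\<close>

lemma sec_le_PK_conj:
  assumes "g \<in> carrier G" "u \<in> sections G" "v \<in> sections G" "sec_le_PK G u v"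
  shows "sec_le_PK G (conj_section G g u) (conj_section G g v)"
proof -
  obtain A B C D where uv: "u = (A, B)" "v = (C, D)" by (cases u, cases v)
  let ?c = "\<lambda>h. inv g \<otimes> h \<otimes> g"
  have sub: "A \<subseteq> carrier G" "D \<subseteq> carrier G"
    using assms uv subgroup.subset by (auto simp: sections_iff)
  have "B = A \<inter> D" "C = A <#> D"
    using assms sec_le_PK_iff uv by auto
  then have "?c ` B = ?c ` A \<inter> ?c ` D" "?c ` C = ?c ` A <#> ?c ` D"
    using inj_on_image_Int[OF inj_on_conj[OF assms(1)] sub] set_mult_hom[OF group_hom.homh[OF group_hom_conj[OF assms(1)]] sub] by simp_all
  moreover have "(?c ` A, ?c ` B) \<in> sections G" "(?c ` C, ?c ` D) \<in> sections G"
    using conj_section_closed assms(1-3) conj_section_eq uv by metis+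
  ultimately show ?thesis
    using assms(1-3) uv by (simp add: sec_le_PK_iff conj_section_eq del: sec_le_PK.simps)
qed

text \<open>Conjugation by an element of \<open>A\<close> preserves \<open>A\<close>, and also
  \<open>D\<close>, as \<open>A \<subseteq> C\<close> and \<open>D\<close> is normal in
  \<open>C\<close>.\<close>

lemma section_meet:
  assumes "(A, B) \<in> sections G" "(C, D) \<in> sections G" "A \<subseteq> C"
  shows "(A, A \<inter> D) \<in> sections G"
  using assms by (auto simp: sections_iff subgroups_Inter_pair subgroup.m_closed subgroup.m_inv_closed)

lemma section_join:
  assumes "(A, B) \<in> sections G" "(C, D) \<in> sections G" "A \<subseteq> C"
  shows "(A <#> D, D) \<in> sections G" "A <#> D \<subseteq> C"
proof -
  have sA: "subgroup A G" and sC: "subgroup C G" and sD: "subgroup D G" and DC: "D \<subseteq> C"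
    and nD: "\<And>p k. p \<in> C \<Longrightarrow> k \<in> D \<Longrightarrow> p \<otimes> k \<otimes> inv p \<in> D"
    using assms by (auto simp: sections_iff)
  show sub: "A <#> D \<subseteq> C"
    using assms(3) DC subgroup.m_closed[OF sC] by (auto simp: set_mult_def)
  have DC': "D \<lhd> G\<lparr>carrier := C\<rparr>" using assms by (simp add: sections_def)
  have AC: "subgroup A (G\<lparr>carrier := C\<rparr>)" using subgroup_incl[OF sA sC assms(3)] .
  \<comment> \<open>Normality of \<open>D\<close> in \<open>C\<close> lets \<open>A\<close> and
    \<open>D\<close> commute as sets, so their product is a subgroup of \<open>C\<close>, hence of
    \<open>G\<close>.\<close>
  have "subgroup (A <#> D) G"
    unfolding commut_normal_subgroup[OF sC DC' AC]
    by (rule incl_subgroup[OF sC mult_norm_sub_in_sub[OF DC' AC sC]])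
  moreover have "D \<subseteq> A <#> D"
    by (rule subset_set_mult(2)[OF sA sD])
  ultimately show "(A <#> D, D) \<in> sections G"
    using sD nD sub by (auto simp: sections_iff)
qed

end

section \<open>Unique factorization of the order and the matrix identity\<close>

theorem theorem3p10:
  fixes G :: "('a, 'b) monoid_scheme"
    and ts :: "('a set \<times> 'a set) list"
  assumes "group G" and "finite (carrier G)"
    and "distinct ts"
    and "orbit_transversal G (conj_section G) (sections G) (set ts)"
  shows "class_incidence_matrix G (conj_section G) (sections G) sec_le ts =
      class_incidence_matrix G (conj_section G) (sections G) sec_le_K ts
    * class_incidence_matrix G (conj_section G) (sections G) (sec_le_PK G) ts
    * class_incidence_matrix G (conj_section G) (sections G) sec_le_P ts"
proof -
  interpret group G by fact
  interpret right_action G "conj_section G" "sections G"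
    by (rule conj_section_right_action)
  let ?M = "\<lambda>r. class_incidence_matrix G (conj_section G) (sections G) r ts"
  \<comment> \<open>The composite of the two lower steps of the factorization; it splits the triple
    product into two applications of \<open>class_incidence_matrix_mult\<close>.\<close>
  define q where "q z x \<longleftrightarrow> (\<exists>y \<in> sections G. sec_le_P z y \<and> sec_le_PK G y x)" for z x
  have "sections G \<subseteq> Pow (carrier G) \<times> Pow (carrier G)"
    using subgroup.subset by (force simp: sections_def)
  then have fin: "finite (sections G)"
    using assms(2) by (meson finite_Pow_iff finite_SigmaI finite_subset)
  have q_iff: "q (A, B) (C, D) \<longleftrightarrow> B \<subseteq> D \<and> C = A <#>\<^bsub>G\<^esub> D"
    if s: "(A, B) \<in> sections G" "(C, D) \<in> sections G" for A B C D
  proof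
    assume "q (A, B) (C, D)"
    then obtain K where "(A, K) \<in> sections G" "B \<subseteq> K" "sec_le_PK G (A, K) (C, D)"
      unfolding q_def by auto
    then show "B \<subseteq> D \<and> C = A <#>\<^bsub>G\<^esub> D" using sec_le_PK_iff s by blast
  next
    assume r: "B \<subseteq> D \<and> C = A <#>\<^bsub>G\<^esub> D"
    have AC: "A \<subseteq> C" using r s subset_set_mult(1) by (simp add: sections_iff)
    have "(A, A \<inter> D) \<in> sections G" using section_meet[OF s AC] .
    moreover have "B \<subseteq> A \<inter> D" using s r by (auto simp: sections_iff)
    \<comment> \<open>The first step keeps \<open>A\<close>, and the second forces the intersection
      with \<open>D\<close>, so this is the only possible middle section.\<close>
    ultimately show "q (A, B) (C, D)"
      unfolding q_def using sec_le_PK_iff[OF _ s(2)] r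
      by (intro bexI[of _ "(A, A \<inter> D)"]) (auto simp del: sec_le_PK.simps)
  qed
  \<comment> \<open>The middle section is \<open>(A <#> D, D)\<close>: \<open>sec_le_K\<close> fixes
    its second component, and \<open>q_iff\<close> then forces the first.\<close>
  have "?M sec_le = ?M sec_le_K * ?M q"
  proof (rule class_incidence_matrix_mult[OF fin assms(3,4)])
    fix g u v assume "g \<in> carrier G" "u \<in> sections G" "v \<in> sections G" "sec_le_K u v"
    then show "sec_le_K (conj_section G g u) (conj_section G g v)"
      by (cases u; cases v) (auto simp: conj_section_eq)
  next
    fix z x assume zx: "z \<in> sections G" "x \<in> sections G"
    obtain A B C D where [simp]: "z = (A, B)" "x = (C, D)" by (cases z, cases x)
    have sub: "A \<subseteq> A <#>\<^bsub>G\<^esub> D" using zx subset_set_mult(1) by (simp add: sections_iff)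
    show "sec_le z x \<longleftrightarrow> (\<exists>y \<in> sections G. q z y \<and> sec_le_K y x)"
    proof
      assume "sec_le z x"
      then show "\<exists>y \<in> sections G. q z y \<and> sec_le_K y x"
        using zx section_join[of A B C D] q_iff[of A B "A <#>\<^bsub>G\<^esub> D" D]
        by (intro bexI[of _ "(A <#>\<^bsub>G\<^esub> D, D)"]) auto
    next
      assume "\<exists>y \<in> sections G. q z y \<and> sec_le_K y x"
      then show "sec_le z x" using zx q_iff sub by fastforce
    qed
  next
    fix z x y y'
    assume "z \<in> sections G" "y \<in> sections G" "y' \<in> sections G"
      "q z y" "sec_le_K y x" "q z y'" "sec_le_K y' x"
    then show "y = y'" using q_iff by (cases z; cases x; cases y; cases y') auto
  qed
  \<comment> \<open>Here \<open>factor\<close> is the definition of \<open>q\<close>. For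
    \<open>unique\<close>, \<open>sec_le_P\<close> fixes the first component of the middle section
    and \<open>sec_le_PK_iff\<close> determines the second.\<close>
  also have "?M q = ?M (sec_le_PK G) * ?M sec_le_P"
  proof (rule class_incidence_matrix_mult[OF fin assms(3,4)])
    fix z x y y'
    assume "z \<in> sections G" "x \<in> sections G" "y \<in> sections G" "y' \<in> sections G"
      "sec_le_P z y" "sec_le_PK G y x" "sec_le_P z y'" "sec_le_PK G y' x"
    then show "y = y'"
      by (cases z; cases x; cases y; cases y') (auto simp: sec_le_PK_iff simp del: sec_le_PK.simps)
  qed (auto simp: q_def intro: sec_le_PK_conj)
  also have "?M sec_le_K * (?M (sec_le_PK G) * ?M sec_le_P)
      = ?M sec_le_K * ?M (sec_le_PK G) * ?M sec_le_P"
    by (rule assoc_mult_mat[symmetric, of _ "length ts" "length ts" _ "length ts" _ "length ts"])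
      (simp_all add: class_incidence_matrix_def)
  finally show ?thesis .
qed

end
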